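(* Let $X,Y$ be lower Eulerian posets with rank functions $\rho_X,\rho_Y$, let $\sigma:X\to Y$ be a strong formal subdivision, and let $\Gamma$ be the associated poset (non-Hausdorff mapping cylinder) described in the context. Fix a weak rank function $r_\Gamma\in I(\Gamma)$ and an element $\kappa_\Gamma\in\mathcal{I}(\Gamma)\cap U(\Gamma)$ that is multiplicative and rank alternating. Then \[ g_\Gamma|_{X/Y}=\Delta\ell_\sigma\cdot g_\Gamma=\Delta\ell_\sigma\cdot g_\Gamma|_Y .\] That is, for all $x\in X$, $y\in Y$ with $\sigma(x)\le y$, \[ g_\Gamma(x,y)=\sum_{\sigma(x)\le y'\le y}\Delta\ell_\sigma(x,y')\,g_Y(y',y).\]
   Context: All posets are finite. For a poset $B$, $\mathrm{Int}(B)$ is the set of closed intervals $[z,z']$ ($z\le z'$). The incidence algebra $I(B)$ is the set of functions $p:\mathrm{Int}(B)\to\mathbb{Z}[t]$ (value written $p(z,z')=p(z,z';t)$), a $\mathbb{Z}[t]$-algebra with pointwise addition and scalar multiplication, product $(p\cdot p')(z,z')=\sum_{z\le z''\le z'}p(z,z'')p'(z'',z')$, and unit $\delta_B$ ($\delta_B(z,z)=1$, $\delta_B(z,z')=0$ for $z\ne z'$). A weak rank function is $r_B\in I(B)$ with $r_B(z,z')\in\mathbb{Z}_{\ge0}$, $r_B(z,z')>0$ for $z<z'$, and $r_B(z,z')=r_B(z,z'')+r_B(z'',z')$ for $z\le z''\le z'$. Given $r_B$: $\mathcal{I}(B)=\{p\in I(B):\deg p(z,z')\le r_B(z,z')\ \forall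 z\le z'\}$ (with $\deg 0=-\infty$), with the ring involution $p^{\mathrm{rev}}(z,z';t)=t^{r_B(z,z')}p(z,z';t^{-1})$; $\mathcal{I}_{1/2}(B)=\{p\in\mathcal{I}(B):\deg p(z,z')<r_B(z,z')/2\ \forall z<z'\}$; $U(B)=\{p:p(z,z)=1\ \forall z\}$. A $B$-kernel is $\kappa_B\in\mathcal{I}(B)\cap U(B)$ with $\kappa_B^{-1}=\kappa_B^{\mathrm{rev}}$; for it there are unique $f_B,g_B\in\mathcal{I}_{1/2}(B)\cap U(B)$ with $f_B^{\mathrm{rev}}=\kappa_B\cdot f_B$ and $g_B^{\mathrm{rev}}=g_B\cdot\kappa_B$ (right and left Kazhdan–Lusztig–Stanley functions). For $p\in\mathcal{I}(B)$, $\Delta p\in\mathcal{I}_{1/2}(B)$ is given by $(\Delta p)(z,z)=0$ and, for $z<z'$ with $p(z,z')=\sum_i a_it^i$, $(\Delta p)(z,z')=a_0+\sum_{i=1}^{\lfloor (r_B(z,z')-1)/2\rfloor}(a_i-a_{i-1})t^i$. A poset $B$ is lower Eulerian if it has a unique minimal element, admits a rank function $\rho_B:B\to\mathbb{Z}$ (with $\rho_B(z')=\rho_B(z)+1$ whenever $z'$ covers $z$), and $\sum_{z\le z''\le z'}(-1)^{\rho_B(z'')}=0$ for all $z<z'$; write $\rho_B(z,z')=\rho_B(z')-\rho_B(z)$. For lower Eulerian $B$ (with any weak rank function $r_B$, not necessarily $\rho_B$), $\widehat{p}(z,z')=(-1)^{\rho_B(z,z')}p(z,z')$; $p\in\mathcal{I}(B)$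 is rank alternating if $p^{\mathrm{rev}}=\widehat p$, and multiplicative if $p(z,z')=p(z,z'')p(z'',z')$ for all $z\le z''\le z'$. A multiplicative rank alternating element of $\mathcal{I}(B)\cap U(B)$ is a $B$-kernel. Setting: $X,Y$ lower Eulerian with rank functions $\rho_X,\rho_Y$; $\sigma:X\to Y$ is a strong formal subdivision, i.e. (1) order-preserving, (2) $\rho_X(x)\le\rho_Y(\sigma(x))$ for all $x$, (3) $\sigma$ is surjective and for all $x\in X,y\in Y$ with $\sigma(x)\le y$ there is $x'\ge x$ in $X$ with $\rho_X(x')=\rho_Y(y)$ and $\sigma(x')=y$, (4) for all $x\in X,y\in Y$ with $\sigma(x)\le y$, $\sum_{x\le x'\in X,\ \sigma(x')=y}(-1)^{\rho_Y(y)-\rho_X(x')}=1$. $\Gamma$ is the poset on the disjoint union $X\sqcup Y$ with the orders of $X$ and of $Y$, and with $x\le y$ ($x\in X,y\in Y$) iff $\sigma(x)\le y$ (no element of $Y$ is below an element of $X$); $\Gamma$ is lower Eulerian with rank function $\rho_\Gamma$ equal to $\rho_X$ on $X$ and $\rho_Y+1$ on $Y$. With the kernel $\kappa_\Gamma$, $f_\Gamma,g_\Gamma$ are its KLS functions; $f_X,g_X$ (resp. $f_Y,g_Y$) denote their restrictions to intervals in $X$ (resp. $Y$). For $p\in\mathcal{I}(\Gamma)$, $p|_X,p|_Y,p|_{X/Y},p|_{(X/Y)^\circ}$ agree with $p$ on intervals $[z,z']$ with, respectively, $z,z'\in X$; $z,z'\in Y$; $z\in X,z'\in Y$; $z\in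 X,z'=\sigma(z)$; and vanish on all other intervals. Define $h_\sigma,\ell_\sigma\in\mathcal{I}(\Gamma)$ by $(t-1)\cdot h_\sigma=g_\Gamma\cdot\kappa_\Gamma|_{(X/Y)^\circ}$ (the right side is divisible by $t-1$) and $\ell_\sigma=h_\sigma\cdot g_\Gamma^{-1}$; $\ell_\sigma(x,y)$ is the local $h$-polynomial of $[x,y]$. *)

theory Defs
  imports "HOL-Computational_Algebra.Polynomial"
begin

text \<open>
  A finite poset is a finite relation \<open>B\<close> with \<open>Partial_order B\<close>; its elements form \<open>Field B\<close> and
  \<open>(z, z') \<in> B\<close> means \<open>z \<le> z'\<close>.  Thus the set \<open>B\<close> of pairs also plays the role of \<open>Int(B)\<close>.
\<close>

definition finite_poset :: "'a rel \<Rightarrow> bool" where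
  "finite_poset B \<longleftrightarrow> finite B \<and> Partial_order B"

definition minimal_elem :: "'a rel \<Rightarrow> 'a \<Rightarrow> bool" where
  "minimal_elem B m \<longleftrightarrow> m \<in> Field B \<and> (\<forall>z. (z, m) \<in> B \<longrightarrow> z = m)"

definition covers :: "'a rel \<Rightarrow> 'a \<Rightarrow> 'a \<Rightarrow> bool" where
  "covers B z' z \<longleftrightarrow> (z, z') \<in> B \<and> z \<noteq> z' \<and> (\<forall>w. (z, w) \<in> B \<and> (w, z') \<in> B \<longrightarrow> w = z \<or> w = z')"

definition rank_function :: "'a rel \<Rightarrow> ('a \<Rightarrow> int) \<Rightarrow> bool" where
  "rank_function B \<rho> \<longleftrightarrow> (\<forall>z z'. covers B z' z \<longrightarrow> \<rho> z' = \<rho> z + 1)"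

text \<open>\<open>(-1)\<^sup>k\<close> for an integer \<open>k\<close>; \<open>k\<close> and \<open>\<bar>k\<bar>\<close> have the same parity.\<close>

definition neg_one_pow :: "int \<Rightarrow> int" where
  "neg_one_pow k = (- 1) ^ nat \<bar>k\<bar>"

definition lower_eulerian :: "'a rel \<Rightarrow> ('a \<Rightarrow> int) \<Rightarrow> bool" where
  "lower_eulerian B \<rho> \<longleftrightarrow>
     finite_poset B \<and> (\<exists>!m. minimal_elem B m) \<and> rank_function B \<rho> \<and>
     (\<forall>z z'. (z, z') \<in> B \<and> z \<noteq> z' \<longrightarrow>
        (\<Sum>w\<in>{w. (z, w) \<in> B \<and> (w, z') \<in> B}. neg_one_pow (\<rho> w)) = 0)"


text \<open>
  A function on intervals is represented by a function of two arguments which vanishes on all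
  pairs that are not intervals, so that equality in \<open>I(B)\<close> is equality of functions.
\<close>

type_synonym 'a inc = "'a \<Rightarrow> 'a \<Rightarrow> int poly"

definition incidence_algebra :: "'a rel \<Rightarrow> 'a inc set" where
  "incidence_algebra B = {p. \<forall>z z'. (z, z') \<notin> B \<longrightarrow> p z z' = 0}"

definition inc_mult :: "'a rel \<Rightarrow> 'a inc \<Rightarrow> 'a inc \<Rightarrow> 'a inc" where
  "inc_mult B p q = (\<lambda>z z'. \<Sum>w\<in>{w. (z, w) \<in> B \<and> (w, z') \<in> B}. p z w * q w z')"

definition inc_smult :: "int poly \<Rightarrow> 'a inc \<Rightarrow> 'a inc" where
  "inc_smult c p = (\<lambda>z z'. c * p z z')"

definition inc_one :: "'a rel \<Rightarrow> 'a inc" where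
  "inc_one B = (\<lambda>z z'. if z = z' \<and> z \<in> Field B then 1 else 0)"

definition inc_inverse :: "'a rel \<Rightarrow> 'a inc \<Rightarrow> 'a inc" where
  "inc_inverse B p =
     (THE q. q \<in> incidence_algebra B \<and> inc_mult B p q = inc_one B \<and> inc_mult B q p = inc_one B)"

definition inc_restrict :: "'a inc \<Rightarrow> 'a rel \<Rightarrow> 'a inc" where
  "inc_restrict p S = (\<lambda>z z'. if (z, z') \<in> S then p z z' else 0)"

text \<open>
  A weak rank function takes non-negative integer values, so it is represented with values in
  \<open>nat\<close>.  Its values on pairs that are not intervals are never used.
\<close>

definition weak_rank_function :: "'a rel \<Rightarrow> ('a \<Rightarrow> 'a \<Rightarrow> nat) \<Rightarrow> bool" where
  "weak_rank_function B r \<longleftrightarrow>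
     (\<forall>z z'. (z, z') \<in> B \<and> z \<noteq> z' \<longrightarrow> r z z' > 0) \<and>
     (\<forall>z w z'. (z, w) \<in> B \<and> (w, z') \<in> B \<longrightarrow> r z z' = r z w + r w z')"

text \<open>
  The convention \<open>degree 0 = 0\<close> (instead of minus infinity) makes no difference in the next two
  definitions, since \<open>r\<close> is non-negative, and positive on non-trivial intervals.
\<close>

definition inc_deg :: "'a rel \<Rightarrow> ('a \<Rightarrow> 'a \<Rightarrow> nat) \<Rightarrow> 'a inc set" where
  "inc_deg B r = {p \<in> incidence_algebra B. \<forall>z z'. (z, z') \<in> B \<longrightarrow> degree (p z z') \<le> r z z'}"

definition inc_half :: "'a rel \<Rightarrow> ('a \<Rightarrow> 'a \<Rightarrow> nat) \<Rightarrow> 'a inc set" where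
  "inc_half B r =
     {p \<in> inc_deg B r. \<forall>z z'. (z, z') \<in> B \<and> z \<noteq> z' \<longrightarrow> real (degree (p z z')) < real (r z z') / 2}"

definition inc_unital :: "'a rel \<Rightarrow> 'a inc set" where
  "inc_unital B = {p \<in> incidence_algebra B. \<forall>z\<in>Field B. p z z = 1}"

text \<open>\<open>t\<^sup>r p(t\<^sup>-\<^sup>1)\<close>, written out in coefficients; meant for \<open>p \<in> inc_deg B r\<close>.\<close>

definition inc_rev :: "('a \<Rightarrow> 'a \<Rightarrow> nat) \<Rightarrow> 'a inc \<Rightarrow> 'a inc" where
  "inc_rev r p = (\<lambda>z z'. \<Sum>i\<le>r z z'. monom (coeff (p z z') i) (r z z' - i))"

definition inc_hat :: "('a \<Rightarrow> int) \<Rightarrow> 'a inc \<Rightarrow> 'a inc" where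
  "inc_hat \<rho> p = (\<lambda>z z'. of_int (neg_one_pow (\<rho> z' - \<rho> z)) * p z z')"

definition rank_alternating :: "('a \<Rightarrow> int) \<Rightarrow> ('a \<Rightarrow> 'a \<Rightarrow> nat) \<Rightarrow> 'a inc \<Rightarrow> bool" where
  "rank_alternating \<rho> r p \<longleftrightarrow> inc_rev r p = inc_hat \<rho> p"

definition multiplicative :: "'a rel \<Rightarrow> 'a inc \<Rightarrow> bool" where
  "multiplicative B p \<longleftrightarrow>
     (\<forall>z w z'. (z, w) \<in> B \<and> (w, z') \<in> B \<longrightarrow> p z z' = p z w * p w z')"

text \<open>The left Kazhdan--Lusztig--Stanley function \<open>g\<close> of a \<open>B\<close>-kernel \<open>\<kappa>\<close>.\<close>

definition left_KLS :: "'a rel \<Rightarrow> ('a \<Rightarrow> 'a \<Rightarrow> nat) \<Rightarrow> 'a inc \<Rightarrow> 'a inc" where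
  "left_KLS B r \<kappa> =
     (THE g. g \<in> inc_half B r \<inter> inc_unital B \<and> inc_rev r g = inc_mult B g \<kappa>)"

text \<open>
  On non-trivial intervals \<open>r z z' > 0\<close>, so the truncated subtraction and division below compute
  the floor of \<open>(r z z' - 1)/2\<close>.
\<close>

definition inc_Delta :: "'a rel \<Rightarrow> ('a \<Rightarrow> 'a \<Rightarrow> nat) \<Rightarrow> 'a inc \<Rightarrow> 'a inc" where
  "inc_Delta B r p = (\<lambda>z z'.
     if (z, z') \<in> B \<and> z \<noteq> z'
     then monom (coeff (p z z') 0) 0 +
          (\<Sum>i=1..(r z z' - 1) div 2. monom (coeff (p z z') i - coeff (p z z') (i - 1)) i)
     else 0)"


definition strong_formal_subdivision ::
    "'a rel \<Rightarrow> ('a \<Rightarrow> int) \<Rightarrow> 'b rel \<Rightarrow> ('b \<Rightarrow> int) \<Rightarrow> ('a \<Rightarrow> 'b) \<Rightarrow> bool" where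
  "strong_formal_subdivision X \<rho>X Y \<rho>Y \<sigma> \<longleftrightarrow>
     (\<forall>x x'. (x, x') \<in> X \<longrightarrow> (\<sigma> x, \<sigma> x') \<in> Y) \<and>
     (\<forall>x\<in>Field X. \<rho>X x \<le> \<rho>Y (\<sigma> x)) \<and>
     \<sigma> ` Field X = Field Y \<and>
     (\<forall>x\<in>Field X. \<forall>y. (\<sigma> x, y) \<in> Y \<longrightarrow>
        (\<exists>x'. (x, x') \<in> X \<and> \<rho>X x' = \<rho>Y y \<and> \<sigma> x' = y)) \<and>
     (\<forall>x\<in>Field X. \<forall>y. (\<sigma> x, y) \<in> Y \<longrightarrow>
        (\<Sum>x'\<in>{x'. (x, x') \<in> X \<and> \<sigma> x' = y}. neg_one_pow (\<rho>Y y - \<rho>X x')) = 1)"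

text \<open>
  The intervals of the non-Hausdorff mapping cylinder \<open>\<Gamma>\<close> of \<open>\<sigma>\<close> on the disjoint union: those in
  \<open>X\<close>, those in \<open>Y\<close>, those from \<open>X\<close> to \<open>Y\<close>, and among the latter those of the form \<open>[x, \<sigma>(x)]\<close>.
\<close>

definition cyl_X :: "'a rel \<Rightarrow> ('a + 'b) rel" where
  "cyl_X X = {(Inl x, Inl x') | x x'. (x, x') \<in> X}"

definition cyl_Y :: "'b rel \<Rightarrow> ('a + 'b) rel" where
  "cyl_Y Y = {(Inr y, Inr y') | y y'. (y, y') \<in> Y}"

definition cyl_XY :: "'a rel \<Rightarrow> 'b rel \<Rightarrow> ('a \<Rightarrow> 'b) \<Rightarrow> ('a + 'b) rel" where
  "cyl_XY X Y \<sigma> = {(Inl x, Inr y) | x y. x \<in> Field X \<and> (\<sigma> x, y) \<in> Y}"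

definition cyl_XYo :: "'a rel \<Rightarrow> ('a \<Rightarrow> 'b) \<Rightarrow> ('a + 'b) rel" where
  "cyl_XYo X \<sigma> = {(Inl x, Inr (\<sigma> x)) | x. x \<in> Field X}"

definition cylinder :: "'a rel \<Rightarrow> 'b rel \<Rightarrow> ('a \<Rightarrow> 'b) \<Rightarrow> ('a + 'b) rel" where
  "cylinder X Y \<sigma> = cyl_X X \<union> cyl_Y Y \<union> cyl_XY X Y \<sigma>"

definition cyl_rank :: "('a \<Rightarrow> int) \<Rightarrow> ('b \<Rightarrow> int) \<Rightarrow> 'a + 'b \<Rightarrow> int" where
  "cyl_rank \<rho>X \<rho>Y = case_sum \<rho>X (\<lambda>y. \<rho>Y y + 1)"

text \<open>
  \<open>h_poly\<close> is the quotient of \<open>g \<cdot> \<kappa>'\<close> by the polynomial \<open>t - 1\<close>, which is \<open>[:-1, 1:]\<close>, where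
  \<open>\<kappa>'\<close> is the restriction of \<open>\<kappa>\<close> to the intervals \<open>[x, \<sigma>(x)]\<close>; \<open>local_h\<close> is the function \<open>\<ell>\<close> of local \<open>h\<close>-polynomials.
\<close>

definition h_poly ::
    "'a rel \<Rightarrow> 'b rel \<Rightarrow> ('a \<Rightarrow> 'b) \<Rightarrow> ('a + 'b \<Rightarrow> 'a + 'b \<Rightarrow> nat) \<Rightarrow> ('a + 'b) inc \<Rightarrow> ('a + 'b) inc" where
  "h_poly X Y \<sigma> r \<kappa> =
     (let \<Gamma> = cylinder X Y \<sigma> in
      THE h. h \<in> inc_deg \<Gamma> r \<and>
        inc_smult [:- 1, 1:] h = inc_mult \<Gamma> (left_KLS \<Gamma> r \<kappa>) (inc_restrict \<kappa> (cyl_XYo X \<sigma>)))"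

definition local_h ::
    "'a rel \<Rightarrow> 'b rel \<Rightarrow> ('a \<Rightarrow> 'b) \<Rightarrow> ('a + 'b \<Rightarrow> 'a + 'b \<Rightarrow> nat) \<Rightarrow> ('a + 'b) inc \<Rightarrow> ('a + 'b) inc" where
  "local_h X Y \<sigma> r \<kappa> =
     (let \<Gamma> = cylinder X Y \<sigma> in
      inc_mult \<Gamma> (h_poly X Y \<sigma> r \<kappa>) (inc_inverse \<Gamma> (left_KLS \<Gamma> r \<kappa>)))"

end

theory Submission
  imports Defs
begin

text \<open>
  Put \<open>m = g|\<^bsub>X/Y\<^esub> \<cdot> g\<^sup>-\<^sup>1\<close>, which has degree less than \<open>r/2\<close>.  Multiplicativity of \<open>\<kappa>\<close> gives
  \<open>\<kappa>|\<^bsub>X/Y\<^esub> = k \<cdot> \<kappa>\<close>, where \<open>k\<close> is the restriction of \<open>\<kappa>\<close> to the intervals \<open>[x, \<sigma>(x)]\<close>.  Restricting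
  \<open>g\<^sup>r\<^sup>e\<^sup>v = g \<cdot> \<kappa>\<close> to \<open>X/Y\<close> therefore yields
  \<open>m\<^sup>r\<^sup>e\<^sup>v \<cdot> g \<cdot> \<kappa> = g \<cdot> k \<cdot> \<kappa> + g|\<^bsub>X/Y\<^esub> \<cdot> \<kappa> = ((t - 1) l + m) \<cdot> g \<cdot> \<kappa>\<close>, and so \<open>m\<^sup>r\<^sup>e\<^sup>v - m = (t - 1) l\<close>.
  By the degree bound, the coefficients of \<open>m\<^sup>r\<^sup>e\<^sup>v\<close> vanish below \<open>r/2\<close>, and reading off those
  coefficients gives \<open>m = \<Delta>l\<close>.
\<close>

section \<open>Reversal of polynomials\<close>

text \<open>The version of \<open>inc_rev\<close> for a single polynomial. Coefficients of index
  above \<open>n\<close> are discarded, so it is t^n p(1/t) exactly when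
  \<open>degree p \<le> n\<close>; this is why the later rules carry degree bounds.\<close>

definition poly_rev :: "nat \<Rightarrow> 'a::comm_ring_1 poly \<Rightarrow> 'a poly" where
  "poly_rev n p = (\<Sum>i\<le>n. monom (coeff p i) (n - i))"

lemma inc_rev_eq_poly_rev: "inc_rev r p z z' = poly_rev (r z z') (p z z')"
  by (simp add: inc_rev_def poly_rev_def)

lemma coeff_poly_rev: "coeff (poly_rev n p) i = (if i \<le> n then coeff p (n - i) else 0)"
proof -
  have "coeff (poly_rev n p) i = (\<Sum>j\<le>n. if n - j = i then coeff p j else 0)"
    by (simp add: poly_rev_def coeff_sum)
  also have "\<dots> = (\<Sum>j\<le>n. if j = n - i then (if i \<le> n then coeff p j else 0) else 0)"
    by (rule sum.cong) auto
  finally show ?thesis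
    by simp
qed

lemma poly_rev_0 [simp]: "poly_rev n 0 = 0"
  by (simp add: poly_rev_def)

lemma poly_rev_0_left_1 [simp]: "poly_rev 0 1 = 1"
  by (simp add: poly_rev_def flip: one_pCons)

lemma poly_rev_diff: "poly_rev n (p - q) = poly_rev n p - poly_rev n q"
  by (rule poly_eqI) (simp add: coeff_poly_rev)

lemma poly_rev_sum: "poly_rev n (sum f A) = (\<Sum>x\<in>A. poly_rev n (f x))"
  by (rule poly_eqI) (simp add: coeff_poly_rev coeff_sum)

text \<open>\<open>reflect_poly\<close> reverses about the actual degree, and the monomial makes up
  the gap to \<open>n\<close>. This gives access to the multiplicativity of
  \<open>reflect_poly\<close>.\<close>

lemma poly_rev_eq_reflect_poly:
  assumes "degree p \<le> n"
  shows "poly_rev n p = monom 1 (n - degree p) * reflect_poly p"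
proof (rule poly_eqI)
  fix i
  show "coeff (poly_rev n p) i = coeff (monom 1 (n - degree p) * reflect_poly p) i"
    using assms
    by (auto simp: coeff_poly_rev coeff_monom_mult coeff_reflect_poly coeff_eq_0
        intro!: arg_cong[where f = "coeff p"])
qed

lemma poly_rev_mult:
  fixes p q :: "'a::idom poly"
  assumes "degree p \<le> m" "degree q \<le> n"
  shows "poly_rev (m + n) (p * q) = poly_rev m p * poly_rev n q"
proof (cases "p = 0 \<or> q = 0")
  case False
  then have "degree (p * q) = degree p + degree q"
    by (simp add: degree_mult_eq)
  then show ?thesis
    using assms
    by (simp add: poly_rev_eq_reflect_poly reflect_poly_mult mult_monom algebra_simps
        flip: mult.assoc)
qed auto

text \<open>Reversal only permutes coefficients, so their sum is unchanged. This detects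
  divisibility by t - 1.\<close>

lemma poly_poly_rev_1:
  assumes "degree p \<le> n"
  shows "poly (poly_rev n p) 1 = poly p 1"
proof -
  have "poly (poly_rev n p) 1 = poly (\<Sum>i\<le>n. monom (coeff p i) i) 1"
    by (simp add: poly_rev_def poly_sum poly_monom)
  also have "\<dots> = poly p 1"
    using assms by (simp add: poly_as_sum_of_monoms')
  finally show ?thesis .
qed

text \<open>Of the indices i and n - i at least one exceeds the degree, and the fixed-point equation
  makes the two coefficients equal. This is the source of uniqueness of KLS functions.\<close>

lemma poly_rev_fixed_imp_0:
  assumes "2 * degree p < n" "poly_rev n p = p"
  shows "p = 0"
proof (rule poly_eqI)
  fix i
  have "coeff p i = (if i \<le> n then coeff p (n - i) else 0)"
    using assms(2) by (metis coeff_poly_rev)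
  moreover have "degree p < i \<or> degree p < n - i"
    using assms(1) by auto
  ultimately show "coeff p i = coeff 0 i"
    by (auto simp: coeff_eq_0 split: if_splits)
qed

text \<open>The polynomial \<open>v\<close> is minus the lower half of \<open>q\<close>.
  Antipalindromicity turns its reversal into the upper half of \<open>q\<close>, which is
  \<open>v + q\<close>. This is the source of existence of KLS functions.\<close>

lemma antipalindromic_split:
  fixes q :: "int poly"
  assumes q: "poly_rev n q = - q" and n: "n > 0"
  obtains v where "2 * degree v < n" "poly_rev n v = v + q"
proof -
  \<comment> \<open>The indices below \<open>(n + 1) div 2\<close> are exactly those with
    \<open>2 * i < n\<close>.\<close>
  define v where "v = - (\<Sum>i<(n + 1) div 2. monom (coeff q i) i)"
  have v: "coeff v i = (if 2 * i < n then - coeff q i else 0)" for i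
    by (auto simp: v_def coeff_sum sum.delta' cong: if_cong)
  have deg: "2 * degree v < n"
    by (metis v n degree_0 leading_coeff_0_iff mult_0_right)
  have cq: "(if i \<le> n then coeff q (n - i) else 0) = - coeff q i" for i
    using q by (metis coeff_minus coeff_poly_rev)
  have "coeff (poly_rev n v) i = coeff (v + q) i" for i
  proof -
    have "2 * (n - i) < n \<longleftrightarrow> n < 2 * i" if "i \<le> n"
      using that by linarith
    \<comment> \<open>In the middle degree the coefficient of \<open>q\<close> equals its own
      negative, so it is 0 over the integers.\<close>
    moreover have "n - i = i" if "2 * i = n"
      using that by linarith
    ultimately show ?thesis
      using cq[of i] by (cases "2 * i" n rule: linorder_cases) (auto simp: coeff_poly_rev v)
  qed
  then show thesis
    using that deg by (simp add: poly_eq_iff)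
qed


section \<open>Incidence algebras of finite posets with a weak rank function\<close>

locale weakly_ranked_poset =
  fixes B :: "'a rel" and r :: "'a \<Rightarrow> 'a \<Rightarrow> nat"
  assumes poset: "finite_poset B"
    and weak_rank: "weak_rank_function B r"
begin

abbreviation interval :: "'a \<Rightarrow> 'a \<Rightarrow> 'a set" where
  "interval z z' \<equiv> {w. (z, w) \<in> B \<and> (w, z') \<in> B}"

lemma refl_B: "z \<in> Field B \<Longrightarrow> (z, z) \<in> B"
  using poset by (auto simp: finite_poset_def partial_order_on_def preorder_on_def refl_on_def)

lemma trans_B: "(z, w) \<in> B \<Longrightarrow> (w, z') \<in> B \<Longrightarrow> (z, z') \<in> B"
  using poset by (auto simp: finite_poset_def partial_order_on_def preorder_on_def dest: transD)

lemma antisym_B: "(z, w) \<in> B \<Longrightarrow> (w, z) \<in> B \<Longrightarrow> z = w"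
  using poset by (auto simp: finite_poset_def partial_order_on_def dest: antisymD)

lemma refl_B_left: "(z, z') \<in> B \<Longrightarrow> (z, z) \<in> B"
  by (simp add: FieldI1 refl_B)

lemma refl_B_right: "(z, z') \<in> B \<Longrightarrow> (z', z') \<in> B"
  by (simp add: FieldI2 refl_B)

lemma finite_interval: "finite (interval z z')"
proof (rule finite_subset)
  show "interval z z' \<subseteq> Field B"
    by (auto intro: FieldI1)
  show "finite (Field B)"
    using poset by (simp add: finite_poset_def finite_Field)
qed

lemma interval_eq_singleton: "(z, z) \<in> B \<Longrightarrow> interval z z = {z}"
  using antisym_B by auto

lemma interval_eq_empty: "(z, z') \<notin> B \<Longrightarrow> interval z z' = {}"
  using trans_B by auto

lemma rank_add: "(z, w) \<in> B \<Longrightarrow> (w, z') \<in> B \<Longrightarrow> r z z' = r z w + r w z'"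
  using weak_rank by (auto simp: weak_rank_function_def)

lemma rank_pos: "(z, z') \<in> B \<Longrightarrow> z \<noteq> z' \<Longrightarrow> 0 < r z z'"
  using weak_rank by (auto simp: weak_rank_function_def)

lemma rank_refl: "(z, z) \<in> B \<Longrightarrow> r z z = 0"
  using rank_add[of z z z] by simp

lemma inc_algebraD: "p \<in> incidence_algebra B \<Longrightarrow> (z, z') \<notin> B \<Longrightarrow> p z z' = 0"
  by (simp add: incidence_algebra_def)

lemma inc_degD: "p \<in> inc_deg B r \<Longrightarrow> (z, z') \<in> B \<Longrightarrow> degree (p z z') \<le> r z z'"
  by (simp add: inc_deg_def)

lemma inc_deg_subset_algebra: "p \<in> inc_deg B r \<Longrightarrow> p \<in> incidence_algebra B"
  by (simp add: inc_deg_def)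

lemma inc_half_iff:
  "p \<in> inc_half B r \<longleftrightarrow> p \<in> inc_deg B r \<and> (\<forall>z z'. (z, z') \<in> B \<and> z \<noteq> z' \<longrightarrow> 2 * degree (p z z') < r z z')"
proof -
  have "real d < real n / 2 \<longleftrightarrow> 2 * d < n" for d n :: nat
    by linarith
  then show ?thesis
    by (simp add: inc_half_def)
qed

text \<open>The weak form of the bound also covers trivial intervals, where membership in
  \<open>inc_deg\<close> and rank 0 force degree 0.\<close>

lemma inc_half_le: "p \<in> inc_half B r \<Longrightarrow> (z, z') \<in> B \<Longrightarrow> 2 * degree (p z z') \<le> r z z'"
  using rank_refl by (cases "z = z'") (fastforce simp: inc_half_iff inc_deg_def)+

lemma inc_restrict_mem_deg: "p \<in> inc_deg B r \<Longrightarrow> inc_restrict p S \<in> inc_deg B r"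
  by (simp add: inc_deg_def incidence_algebra_def inc_restrict_def)

section \<open>Ring structure of the incidence algebra, degree bounds and reversal\<close>

lemma inc_mult_mem: "inc_mult B p q \<in> incidence_algebra B"
  by (simp add: incidence_algebra_def inc_mult_def interval_eq_empty)

lemma inc_one_mem: "inc_one B \<in> incidence_algebra B"
  using refl_B by (auto simp: incidence_algebra_def inc_one_def)

text \<open>Both sides sum over chains z \<le> u \<le> w \<le> z'; only the order of summation
  differs.\<close>

lemma inc_mult_assoc: "inc_mult B (inc_mult B p q) s = inc_mult B p (inc_mult B q s)"
proof (intro ext)
  fix z z'
  let ?I = "interval z z'"
  have "inc_mult B (inc_mult B p q) s z z'
      = (\<Sum>w\<in>?I. \<Sum>u\<in>{u \<in> ?I. (u, w) \<in> B}. p z u * q u w * s w z')"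
    unfolding inc_mult_def sum_distrib_right by (intro sum.cong) (auto intro: trans_B)
  also have "\<dots> = (\<Sum>u\<in>?I. \<Sum>w\<in>{w \<in> ?I. (u, w) \<in> B}. p z u * q u w * s w z')"
    by (rule sum.swap_restrict) (rule finite_interval)+
  also have "\<dots> = inc_mult B p (inc_mult B q s) z z'"
    unfolding inc_mult_def sum_distrib_left
    by (intro sum.cong) (auto intro: trans_B simp: mult.assoc)
  finally show "inc_mult B (inc_mult B p q) s z z' = inc_mult B p (inc_mult B q s) z z'" .
qed

lemma inc_mult_one_left:
  assumes "p \<in> incidence_algebra B"
  shows "inc_mult B (inc_one B) p = p"
proof (intro ext)
  fix z z'
  show "inc_mult B (inc_one B) p z z' = p z z'"
  proof (cases "(z, z') \<in> B")
    case True
    then have "inc_mult B (inc_one B) p z z' = (\<Sum>w\<in>{z}. inc_one B z w * p w z')"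
      unfolding inc_mult_def
      by (intro sum.mono_neutral_right finite_interval) (auto simp: inc_one_def refl_B_left)
    then show ?thesis
      using True by (simp add: inc_one_def FieldI1)
  next
    case False
    then show ?thesis
      using assms inc_mult_mem by (simp add: inc_algebraD)
  qed
qed

lemma inc_mult_one_right:
  assumes "p \<in> incidence_algebra B"
  shows "inc_mult B p (inc_one B) = p"
proof (intro ext)
  fix z z'
  show "inc_mult B p (inc_one B) z z' = p z z'"
  proof (cases "(z, z') \<in> B")
    case True
    then have "inc_mult B p (inc_one B) z z' = (\<Sum>w\<in>{z'}. p z w * inc_one B w z')"
      unfolding inc_mult_def
      by (intro sum.mono_neutral_right finite_interval) (auto simp: inc_one_def refl_B_right)
    then show ?thesis
      using True by (simp add: inc_one_def FieldI2)
  next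
    case False
    then show ?thesis
      using assms inc_mult_mem by (simp add: inc_algebraD)
  qed
qed

lemma inc_mult_add_left:
  "inc_mult B (\<lambda>z z'. p z z' + q z z') s = (\<lambda>z z'. inc_mult B p s z z' + inc_mult B q s z z')"
  by (simp add: inc_mult_def distrib_right sum.distrib)

lemma inc_mult_smult_left: "inc_mult B (inc_smult c p) q = inc_smult c (inc_mult B p q)"
  by (simp add: inc_mult_def inc_smult_def sum_distrib_left mult.assoc)

lemma inc_mult_smult_right: "inc_mult B p (inc_smult c q) = inc_smult c (inc_mult B p q)"
  by (simp add: inc_mult_def inc_smult_def sum_distrib_left mult.left_commute)

lemma inc_mult_mem_deg:
  assumes p: "p \<in> inc_deg B r" and q: "q \<in> inc_deg B r"
  shows "inc_mult B p q \<in> inc_deg B r"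
proof -
  have "degree (inc_mult B p q z z') \<le> r z z'" for z z'
    unfolding inc_mult_def
  proof (rule degree_sum_le[OF finite_interval])
    fix w
    assume "w \<in> interval z z'"
    then have "degree (p z w) + degree (q w z') \<le> r z z'"
      using p q rank_add[of z w z'] by (simp add: add_mono inc_degD)
    then show "degree (p z w * q w z') \<le> r z z'"
      using degree_mult_le order_trans by blast
  qed
  then show ?thesis
    using inc_mult_mem by (auto simp: inc_deg_def)
qed

text \<open>Since \<open>r\<close> is additive along z \<le> w \<le> z',
  \<open>poly_rev_mult\<close> applies to each summand.\<close>

lemma inc_rev_mult:
  assumes p: "p \<in> inc_deg B r" and q: "q \<in> inc_deg B r"
  shows "inc_rev r (inc_mult B p q) = inc_mult B (inc_rev r p) (inc_rev r q)"
proof (intro ext)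
  fix z z'
  show "inc_rev r (inc_mult B p q) z z' = inc_mult B (inc_rev r p) (inc_rev r q) z z'"
    unfolding inc_rev_eq_poly_rev inc_mult_def poly_rev_sum
    using p q by (intro sum.cong) (auto simp: rank_add poly_rev_mult inc_degD)
qed

text \<open>Because \<open>p z z = 1\<close>, the equation at [z, z'] expresses
  \<open>q z z'\<close> through the values at [w, z'] with z < w. These intervals have smaller rank,
  so \<open>q\<close> is built by recursion on \<open>r\<close>.\<close>

lemma right_inverse_exists:
  assumes p: "p \<in> inc_unital B"
  obtains q where "q \<in> inc_unital B" "inc_mult B p q = inc_one B"
proof -
  \<comment> \<open>\<open>P f (z, z') v\<close> says that \<open>v\<close> is the right value at
    (z, z') given \<open>f\<close> on intervals of smaller rank, the form needed for
    \<open>dependent_wf_choice\<close>.\<close>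
  define P where "P = (\<lambda>f (z, z') v. if (z, z') \<in> B then
    (if z = z' then v = 1 else v = - (\<Sum>w\<in>interval z z' - {z}. p z w * f (w, z'))) else v = 0)"
  have "\<exists>f. \<forall>x. P f x (f x)"
  proof (rule dependent_wf_choice[of "measure (\<lambda>(z, z'). r z z')"])
    fix f g :: "'a \<times> 'a \<Rightarrow> int poly" and x v
    assume fg: "\<And>y. (y, x) \<in> measure (\<lambda>(z, z'). r z z') \<Longrightarrow> f y = g y"
    obtain z z' where x: "x = (z, z')"
      by fastforce
    have "f (w, z') = g (w, z')" if "w \<in> interval z z' - {z}" for w
      using that by (intro fg) (auto simp: x rank_add[of z w z'] intro!: rank_pos)
    then show "P f x v = P g x v"
      by (simp add: x P_def)
  next
    fix x and f :: "'a \<times> 'a \<Rightarrow> int poly"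
    show "\<exists>v. P f x v"
      by (cases x) (auto simp: P_def)
  qed simp
  then obtain f where f: "P f (z, z') (f (z, z'))" for z z'
    by fastforce
  define q where "q = (\<lambda>z z'. f (z, z'))"
  have qB: "q z z' = 0" if "(z, z') \<notin> B" for z z'
    using f[of z z'] that by (simp add: P_def q_def)
  have q1: "q z z = 1" if "(z, z) \<in> B" for z
    using f[of z z] that by (simp add: P_def q_def)
  have q: "q z z' = - (\<Sum>w\<in>interval z z' - {z}. p z w * q w z')" if "(z, z') \<in> B" "z \<noteq> z'" for z z'
    using f[of z z'] that by (simp add: P_def q_def)
  have p1: "p z z = 1" if "(z, z) \<in> B" for z
    using p that by (auto simp: inc_unital_def dest: FieldI1)
  have "inc_mult B p q z z' = inc_one B z z'" for z z'
  proof -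
    consider "(z, z') \<notin> B" | "(z, z') \<in> B" "z = z'" | "(z, z') \<in> B" "z \<noteq> z'"
      by blast
    then show ?thesis
    proof cases
      case 1
      then show ?thesis
        using inc_mult_mem inc_one_mem by (simp add: inc_algebraD)
    next
      case 2
      then show ?thesis
        by (auto simp: inc_mult_def interval_eq_singleton p1 q1 inc_one_def dest: FieldI1)
    next
      case 3
      have "inc_mult B p q z z' = p z z * q z z' + (\<Sum>w\<in>interval z z' - {z}. p z w * q w z')"
        unfolding inc_mult_def
        by (rule sum.remove[OF finite_interval]) (use 3 in \<open>simp add: refl_B_left\<close>)
      then show ?thesis
        using 3 q[OF 3] p1[of z] by (simp add: refl_B_left inc_one_def)
    qed
  qed
  moreover have "q \<in> inc_unital B"
    using qB q1 refl_B by (simp add: inc_unital_def incidence_algebra_def)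
  ultimately show thesis
    using that by blast
qed

text \<open>A right inverse \<open>q\<close> of \<open>p\<close> has a right inverse
  \<open>s\<close> in turn, and associativity gives \<open>p = s\<close>. Hence \<open>q\<close> is
  two-sided and unique, so the description in \<open>inc_inverse\<close> is well defined.\<close>

lemma inc_inverse:
  assumes p: "p \<in> inc_unital B"
  shows "inc_inverse B p \<in> inc_unital B"
    and "inc_mult B p (inc_inverse B p) = inc_one B"
    and "inc_mult B (inc_inverse B p) p = inc_one B"
proof -
  obtain q where q: "q \<in> inc_unital B" "inc_mult B p q = inc_one B"
    using right_inverse_exists[OF p] .
  obtain s where s: "s \<in> inc_unital B" "inc_mult B q s = inc_one B"
    using right_inverse_exists[OF q(1)] .
  have mem: "p \<in> incidence_algebra B" "q \<in> incidence_algebra B" "s \<in> incidence_algebra B"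
    using p q s by (auto simp: inc_unital_def)
  have "p = s"
    using inc_mult_assoc[of p q s] mem by (simp add: q s inc_mult_one_left inc_mult_one_right)
  then have qp: "inc_mult B q p = inc_one B"
    using s by simp
  have "inc_inverse B p = q"
    unfolding inc_inverse_def
  proof (rule the_equality)
    fix q'
    assume q': "q' \<in> incidence_algebra B \<and> inc_mult B p q' = inc_one B \<and> inc_mult B q' p = inc_one B"
    then show "q' = q"
      using inc_mult_assoc[of q' p q] mem by (simp add: q inc_mult_one_left inc_mult_one_right)
  qed (simp add: mem q qp)
  then show "inc_inverse B p \<in> inc_unital B" "inc_mult B p (inc_inverse B p) = inc_one B"
    "inc_mult B (inc_inverse B p) p = inc_one B"
    using q qp by simp_all
qed

lemma inc_mult_right_cancel:
  assumes "s \<in> inc_unital B" "p \<in> incidence_algebra B" "q \<in> incidence_algebra B"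
    and "inc_mult B p s = inc_mult B q s"
  shows "p = q"
  using assms by (metis inc_inverse(2) inc_mult_assoc inc_mult_one_right)

text \<open>If z < z', then for each w at least one of [z, w] and [w, z'] is nontrivial and supplies
  a strict inequality.\<close>

lemma inc_mult_mem_half:
  assumes p: "p \<in> inc_half B r" and q: "q \<in> inc_half B r"
  shows "inc_mult B p q \<in> inc_half B r"
proof -
  have "2 * degree (inc_mult B p q z z') < r z z'" if "(z, z') \<in> B" "z \<noteq> z'" for z z'
  proof -
    \<comment> \<open>The bound is the largest d with 2 d < \<open>r z z'\<close>;
      \<open>degree_sum_le\<close> needs a weak inequality.\<close>
    have "degree (p z w * q w z') \<le> (r z z' - 1) div 2" if w: "w \<in> interval z z'" for w
    proof -
      have "2 * degree (p z w) < r z w \<or> 2 * degree (q w z') < r w z'"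
        using p q w \<open>z \<noteq> z'\<close> by (auto simp: inc_half_iff)
      moreover have "2 * degree (p z w) \<le> r z w" "2 * degree (q w z') \<le> r w z'"
        using p q w by (auto intro: inc_half_le)
      ultimately show ?thesis
        using rank_add[of z w z'] w degree_mult_le[of "p z w" "q w z'"] by auto
    qed
    then have "degree (inc_mult B p q z z') \<le> (r z z' - 1) div 2"
      unfolding inc_mult_def by (intro degree_sum_le finite_interval)
    then show ?thesis
      using rank_pos[OF that] by linarith
  qed
  moreover have "inc_mult B p q \<in> inc_deg B r"
    using p q by (simp add: inc_half_def inc_mult_mem_deg)
  ultimately show ?thesis
    by (simp add: inc_half_iff)
qed

text \<open>Induction on rank along the recursion for the inverse: the factor \<open>p z w\<close>
  with z < w satisfies the strict bound. The weak bound is proved along with it to cover the summand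
  w = z'.\<close>

lemma inc_inverse_mem_half:
  assumes p: "p \<in> inc_half B r" "p \<in> inc_unital B"
  shows "inc_inverse B p \<in> inc_half B r"
proof -
  let ?q = "inc_inverse B p"
  have bound: "2 * degree (?q z z') \<le> r z z' \<and> (z \<noteq> z' \<longrightarrow> 2 * degree (?q z z') < r z z')"
    if "(z, z') \<in> B" for z z'
    using that
  proof (induction "r z z'" arbitrary: z rule: less_induct)
    case less
    show ?case
    proof (cases "z = z'")
      case True
      then have "?q z z' = 1"
        using inc_inverse(1)[OF p(2)] less.prems by (auto simp: inc_unital_def dest: FieldI1)
      then show ?thesis
        using True by simp
    next
      case False
      have "0 = inc_mult B p ?q z z'"
        using False by (simp add: inc_inverse(2)[OF p(2)] inc_one_def)
      also have "\<dots> = p z z * ?q z z' + (\<Sum>w\<in>interval z z' - {z}. p z w * ?q w z')"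
        unfolding inc_mult_def
        by (rule sum.remove[OF finite_interval]) (use less.prems in \<open>simp add: refl_B_left\<close>)
      also have "p z z = 1"
        using p(2) less.prems by (auto simp: inc_unital_def dest: FieldI1)
      finally have q: "?q z z' = - (\<Sum>w\<in>interval z z' - {z}. p z w * ?q w z')"
        by (simp add: eq_neg_iff_add_eq_0)
      have "degree (p z w * ?q w z') \<le> (r z z' - 1) div 2" if w: "w \<in> interval z z' - {z}" for w
      proof -
        have "2 * degree (p z w) < r z w"
          using p(1) w by (auto simp: inc_half_iff)
        moreover have "r z z' = r z w + r w z'" "0 < r z w"
          using w by (auto intro: rank_add rank_pos)
        moreover from this have "2 * degree (?q w z') \<le> r w z'"
          using less.hyps[of w] w by simp
        ultimately show ?thesis
          using degree_mult_le[of "p z w" "?q w z'"] by linarith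
      qed
      then have "degree (?q z z') \<le> (r z z' - 1) div 2"
        unfolding q degree_minus by (intro degree_sum_le) (simp_all add: finite_interval)
      then show ?thesis
        using rank_pos[OF less.prems False] by linarith
    qed
  qed
  have "degree (?q z z') \<le> r z z'" if "(z, z') \<in> B" for z z'
    using bound[OF that] by linarith
  then show ?thesis
    using bound inc_inverse(1)[OF p(2)] by (auto simp: inc_half_iff inc_deg_def inc_unital_def)
qed

text \<open>At [z, z'] the KLS equation reads rev(v) = v + q, where q involves only values on
  smaller intervals. The kernel identity makes q antipalindromic, so
  \<open>antipalindromic_split\<close> gives a solution, and \<open>poly_rev_fixed_imp_0\<close>
  makes it unique. Together these justify the description in \<open>left_KLS\<close>.\<close>

lemma left_KLS:
  assumes \<kappa>: "\<kappa> \<in> inc_deg B r" "\<kappa> \<in> inc_unital B"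
    and kernel: "inc_mult B \<kappa> (inc_rev r \<kappa>) = inc_one B"
  shows "left_KLS B r \<kappa> \<in> inc_half B r" "left_KLS B r \<kappa> \<in> inc_unital B"
    "inc_rev r (left_KLS B r \<kappa>) = inc_mult B (left_KLS B r \<kappa>) \<kappa>"
proof -
  have \<kappa>1: "\<kappa> z z = 1" if "(z, z) \<in> B" for z
    using \<kappa>(2) that by (auto simp: inc_unital_def dest: FieldI1)
  have split_top: "(\<Sum>w\<in>interval z z'. f z w * \<kappa> w z')
      = f z z' + (\<Sum>w\<in>interval z z' - {z'}. f z w * \<kappa> w z')"
    if "(z, z') \<in> B" for f z z'
    using sum.remove[OF finite_interval, of z' z z' "\<lambda>w. f z w * \<kappa> w z'"] that
    by (simp add: \<kappa>1 refl_B_right)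
  \<comment> \<open>This is the KLS condition at (z, z') with the top term w = z' split off, so that
    \<open>v\<close> occurs only outside the sum.\<close>
  define P where "P = (\<lambda>f (z, z') v. if (z, z') \<in> B then
      (if z = z' then v = 1 else 2 * degree v < r z z' \<and>
        poly_rev (r z z') v = v + (\<Sum>w\<in>interval z z' - {z'}. f (z, w) * \<kappa> w z'))
    else v = 0)"
  have "\<exists>f. \<forall>x. P f x (f x)"
  proof (rule dependent_wf_choice[of "measure (\<lambda>(z, z'). r z z')"])
    fix f g :: "'a \<times> 'a \<Rightarrow> int poly" and x v
    assume fg: "\<And>y. (y, x) \<in> measure (\<lambda>(z, z'). r z z') \<Longrightarrow> f y = g y"
    obtain z z' where x: "x = (z, z')"
      by fastforce
    have "f (z, w) = g (z, w)" if "w \<in> interval z z' - {z'}" for w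
      using that by (intro fg) (auto simp: x rank_add[of z w z'] intro!: rank_pos)
    then show "P f x v = P g x v"
      by (simp add: x P_def)
  next
    fix x and f :: "'a \<times> 'a \<Rightarrow> int poly"
    assume IH: "\<And>y. (y, x) \<in> measure (\<lambda>(z, z'). r z z') \<Longrightarrow> P f y (f y)"
    obtain z z' where x: "x = (z, z')"
      by fastforce
    show "\<exists>v. P f x v"
    proof (cases "(z, z') \<in> B \<and> z \<noteq> z'")
      case True
      then have zz': "(z, z') \<in> B" "z \<noteq> z'"
        by auto
      let ?I = "interval z z'" and ?\<kappa>' = "inc_rev r \<kappa>"
      let ?J = "?I - {z'}"
      let ?q = "\<Sum>w\<in>?J. f (z, w) * \<kappa> w z'"
      have Pf: "P f (z, w) (f (z, w))" if "w \<in> ?J" for w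
        using that by (intro IH) (auto simp: x rank_add[of z w z'] intro!: rank_pos)
      have deg: "degree (f (z, w)) \<le> r z w" if "w \<in> ?J" for w
        using Pf[OF that] by (auto simp: P_def split: if_splits)
      \<comment> \<open>At w = z the predicate \<open>P\<close> records only the value 1, so that
        case of the KLS equation is verified separately.\<close>
      have rev_f: "poly_rev (r z w) (f (z, w)) = (\<Sum>u\<in>interval z w. f (z, u) * \<kappa> u w)"
        if "w \<in> ?J" for w
        using Pf[OF that] that split_top[of z w "\<lambda>z w. f (z, w)"]
        by (auto simp: P_def interval_eq_singleton \<kappa>1 rank_refl split: if_splits)
      have "poly_rev (r z z') ?q = (\<Sum>w\<in>?J. poly_rev (r z w) (f (z, w)) * ?\<kappa>' w z')"
        unfolding poly_rev_sum
      proof (intro sum.cong refl)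
        fix w
        assume w: "w \<in> ?J"
        then show "poly_rev (r z z') (f (z, w) * \<kappa> w z') = poly_rev (r z w) (f (z, w)) * ?\<kappa>' w z'"
          using deg[OF w] \<kappa>(1)
          by (simp add: rank_add[of z w z'] poly_rev_mult inc_degD inc_rev_eq_poly_rev)
      qed
      \<comment> \<open>Each reversed value is replaced by its KLS sum on the smaller interval
        [z, w]. After exchanging the sums, the inner sum over w is a kernel sum lacking only its top
        term.\<close>
      also have "\<dots> = (\<Sum>w\<in>?J. \<Sum>u\<in>{u \<in> ?J. (u, w) \<in> B}. f (z, u) * \<kappa> u w * ?\<kappa>' w z')"
      proof (intro sum.cong refl)
        fix w
        assume w: "w \<in> ?J"
        then have "interval z w = {u \<in> ?J. (u, w) \<in> B}"
          by (auto intro: trans_B dest: antisym_B)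
        then show "poly_rev (r z w) (f (z, w)) * ?\<kappa>' w z'
            = (\<Sum>u\<in>{u \<in> ?J. (u, w) \<in> B}. f (z, u) * \<kappa> u w * ?\<kappa>' w z')"
          using rev_f[OF w] by (simp add: sum_distrib_right)
      qed
      also have "\<dots> = (\<Sum>u\<in>?J. \<Sum>w\<in>{w \<in> ?J. (u, w) \<in> B}. f (z, u) * \<kappa> u w * ?\<kappa>' w z')"
        by (rule sum.swap_restrict) (simp_all add: finite_interval)
      also have "\<dots> = (\<Sum>u\<in>?J. - (f (z, u) * \<kappa> u z'))"
      proof (intro sum.cong refl)
        fix u
        assume u: "u \<in> ?J"
        have J: "{w \<in> ?J. (u, w) \<in> B} = interval u z' - {z'}"
          using u by (auto intro: trans_B)
        \<comment> \<open>The full kernel sum vanishes as u differs from z'. Its top term is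
          \<open>\<kappa> u z'\<close>, so the remaining terms add up to the negative of it.\<close>
        have "0 = inc_mult B \<kappa> ?\<kappa>' u z'"
          using u by (simp add: kernel inc_one_def)
        also have "\<dots> = \<kappa> u z' * ?\<kappa>' z' z' + (\<Sum>w\<in>interval u z' - {z'}. \<kappa> u w * ?\<kappa>' w z')"
          unfolding inc_mult_def
          by (rule sum.remove[OF finite_interval]) (use u in \<open>auto intro: refl_B_right\<close>)
        also have "?\<kappa>' z' z' = 1"
          using u refl_B_right[of u z'] by (simp add: inc_rev_eq_poly_rev rank_refl \<kappa>1)
        finally have "(\<Sum>w\<in>interval u z' - {z'}. \<kappa> u w * ?\<kappa>' w z') = - \<kappa> u z'"
          by (simp add: eq_neg_iff_add_eq_0 add.commute)
        then show "(\<Sum>w\<in>{w \<in> ?J. (u, w) \<in> B}. f (z, u) * \<kappa> u w * ?\<kappa>' w z') = - (f (z, u) * \<kappa> u z')"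
          unfolding J by (simp add: mult.assoc flip: sum_distrib_left)
      qed
      finally have "poly_rev (r z z') ?q = - ?q"
        by (simp add: sum_negf)
      then obtain v where "2 * degree v < r z z'" "poly_rev (r z z') v = v + ?q"
        using antipalindromic_split rank_pos[OF zz'] by blast
      then show ?thesis
        using zz' by (auto simp: x P_def)
    qed (auto simp: x P_def)
  qed simp
  then obtain f where f: "P f (z, z') (f (z, z'))" for z z'
    by fastforce
  define g where "g = (\<lambda>z z'. f (z, z'))"
  have gB: "g z z' = 0" if "(z, z') \<notin> B" for z z'
    using f[of z z'] that by (simp add: P_def g_def)
  have g1: "g z z = 1" if "(z, z) \<in> B" for z
    using f[of z z] that by (simp add: P_def g_def)
  have g_deg: "2 * degree (g z z') < r z z'"
    and g_rev: "poly_rev (r z z') (g z z') = inc_mult B g \<kappa> z z'"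
    if "(z, z') \<in> B" "z \<noteq> z'" for z z'
    using f[of z z'] that split_top[of z z' g] by (auto simp: P_def g_def inc_mult_def)
  have "degree (g z z') \<le> r z z'" if "(z, z') \<in> B" for z z'
    using g_deg[OF that] g1[of z] that by (cases "z = z'") auto
  then have half: "g \<in> inc_half B r"
    using gB g_deg by (simp add: inc_half_iff inc_deg_def incidence_algebra_def)
  have unital: "g \<in> inc_unital B"
    using gB g1 refl_B by (simp add: inc_unital_def incidence_algebra_def)
  have rev: "inc_rev r g = inc_mult B g \<kappa>"
  proof (intro ext)
    fix z z'
    consider "(z, z') \<notin> B" | "(z, z') \<in> B" "z = z'" | "(z, z') \<in> B" "z \<noteq> z'"
      by blast
    then show "inc_rev r g z z' = inc_mult B g \<kappa> z z'"
    proof cases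
      case 1
      then show ?thesis
        using inc_mult_mem by (simp add: inc_algebraD inc_rev_eq_poly_rev gB)
    next
      case 2
      then show ?thesis
        by (auto simp: inc_mult_def interval_eq_singleton \<kappa>1 g1 inc_rev_eq_poly_rev rank_refl)
    next
      case 3
      then show ?thesis
        by (simp add: inc_rev_eq_poly_rev g_rev)
    qed
  qed
  have "left_KLS B r \<kappa> = g"
    unfolding left_KLS_def
  proof (rule the_equality)
    fix g'
    assume "g' \<in> inc_half B r \<inter> inc_unital B \<and> inc_rev r g' = inc_mult B g' \<kappa>"
    then have g': "g' \<in> inc_half B r" "g' \<in> inc_unital B" "inc_rev r g' = inc_mult B g' \<kappa>"
      by auto
    have "g' z z' = g z z'" for z z'
    proof (cases "(z, z') \<in> B")
      case True
      then show ?thesis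
      proof (induction "r z z'" arbitrary: z' rule: less_induct)
        case less
        show ?case
        proof (cases "z = z'")
          case True
          then show ?thesis
            using g'(2) g1 less.prems by (auto simp: inc_unital_def dest: FieldI1)
        next
          case False
          let ?n = "r z z'" and ?d = "g' z z' - g z z'"
          have eq: "g' z w = g z w" if "w \<in> interval z z' - {z'}" for w
            using that less.hyps[of w] rank_add[of z w z'] rank_pos[of w z'] by auto
          \<comment> \<open>By induction the two products agree except in the term w = z', so the
            difference of the candidates is fixed by reversal.\<close>
          have "poly_rev ?n ?d = inc_mult B g' \<kappa> z z' - inc_mult B g \<kappa> z z'"
            by (simp add: poly_rev_diff flip: inc_rev_eq_poly_rev g'(3) rev)
          also have "\<dots> = ?d"
            unfolding inc_mult_def split_top[OF less.prems] using eq by simp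
          finally have "poly_rev ?n ?d = ?d" .
          moreover have "2 * degree (g' z z') < ?n"
            using g'(1) less.prems False by (simp add: inc_half_iff)
          then have "2 * degree ?d < ?n"
            using degree_diff_le_max[of "g' z z'" "g z z'"] g_deg[OF less.prems False] by linarith
          ultimately have "?d = 0"
            using poly_rev_fixed_imp_0 by blast
          then show ?thesis
            by simp
        qed
      qed
    next
      case False
      then show ?thesis
        using g'(2) gB by (simp add: inc_unital_def incidence_algebra_def)
    qed
    then show "g' = g"
      by (intro ext)
  qed (use half unital rev in simp)
  then show "left_KLS B r \<kappa> \<in> inc_half B r" "left_KLS B r \<kappa> \<in> inc_unital B"
    "inc_rev r (left_KLS B r \<kappa>) = inc_mult B (left_KLS B r \<kappa>) \<kappa>"
    using half unital rev by simp_all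
qed

end

section \<open>Signs and multiplicative kernels\<close>

lemma neg_one_pow_eq: "neg_one_pow k = (if even k then 1 else - 1)"
  by (simp add: neg_one_pow_def even_nat_iff)

lemma neg_one_pow_diff: "neg_one_pow (a - b) = neg_one_pow a * neg_one_pow b"
  by (auto simp: neg_one_pow_eq)

context weakly_ranked_poset
begin

text \<open>Rank alternation and multiplicativity turn every summand into
  \<open>\<kappa> z z'\<close> times a sign, which leaves the alternating sum in
  \<open>euler\<close> as a factor.\<close>

lemma multiplicative_rank_alternating_kernel:
  assumes \<kappa>: "\<kappa> \<in> inc_unital B"
    and mult: "multiplicative B \<kappa>" and alt: "rank_alternating \<rho> r \<kappa>"
    and euler: "\<And>z z'. (z, z') \<in> B \<Longrightarrow> z \<noteq> z' \<Longrightarrow> (\<Sum>w\<in>interval z z'. neg_one_pow (\<rho> w)) = 0"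
  shows "inc_mult B \<kappa> (inc_rev r \<kappa>) = inc_one B"
proof (intro ext)
  fix z z'
  consider "(z, z') \<notin> B" | "(z, z') \<in> B" "z = z'" | "(z, z') \<in> B" "z \<noteq> z'"
    by blast
  then show "inc_mult B \<kappa> (inc_rev r \<kappa>) z z' = inc_one B z z'"
  proof cases
    case 1
    then show ?thesis
      using inc_mult_mem inc_one_mem by (simp add: inc_algebraD)
  next
    case 2
    then have "z \<in> Field B"
      by (simp add: FieldI1)
    then show ?thesis
      using 2 \<kappa> by (simp add: inc_mult_def interval_eq_singleton inc_rev_eq_poly_rev
          rank_refl inc_unital_def inc_one_def)
  next
    case 3
    have "inc_mult B \<kappa> (inc_rev r \<kappa>) z z'
        = (\<Sum>w\<in>interval z z'. \<kappa> z z' * of_int (neg_one_pow (\<rho> z') * neg_one_pow (\<rho> w)))"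
      unfolding inc_mult_def
    proof (intro sum.cong refl)
      fix w
      assume "w \<in> interval z z'"
      then have "\<kappa> z z' = \<kappa> z w * \<kappa> w z'"
        using mult by (simp add: multiplicative_def)
      then show "\<kappa> z w * inc_rev r \<kappa> w z'
          = \<kappa> z z' * of_int (neg_one_pow (\<rho> z') * neg_one_pow (\<rho> w))"
        using alt by (simp add: rank_alternating_def inc_hat_def neg_one_pow_diff)
    qed
    also have "\<dots> = \<kappa> z z' * of_int (neg_one_pow (\<rho> z') * (\<Sum>w\<in>interval z z'. neg_one_pow (\<rho> w)))"
      by (simp add: sum_distrib_left)
    finally show ?thesis
      using 3 euler by (simp add: inc_one_def)
  qed
qed

end


section \<open>The mapping cylinder\<close>

lemma cylinder_simps [simp]:
  "(Inl x, Inl x') \<in> cylinder X Y \<sigma> \<longleftrightarrow> (x, x') \<in> X"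
  "(Inr y, Inr y') \<in> cylinder X Y \<sigma> \<longleftrightarrow> (y, y') \<in> Y"
  "(Inl x, Inr y) \<in> cylinder X Y \<sigma> \<longleftrightarrow> x \<in> Field X \<and> (\<sigma> x, y) \<in> Y"
  "(Inr y, Inl x) \<notin> cylinder X Y \<sigma>"
  by (auto simp: cylinder_def cyl_X_def cyl_Y_def cyl_XY_def)

lemma cyl_XY_simps [simp]:
  "(z, Inl x') \<notin> cyl_XY X Y \<sigma>"
  "(Inr y, z) \<notin> cyl_XY X Y \<sigma>"
  "(Inl x, Inr y) \<in> cyl_XY X Y \<sigma> \<longleftrightarrow> x \<in> Field X \<and> (\<sigma> x, y) \<in> Y"
  by (auto simp: cyl_XY_def)

lemma cyl_XYo_simps [simp]:
  "(z, Inl x') \<notin> cyl_XYo X \<sigma>"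
  "(Inr y, z) \<notin> cyl_XYo X \<sigma>"
  "(Inl x, Inr y) \<in> cyl_XYo X \<sigma> \<longleftrightarrow> x \<in> Field X \<and> y = \<sigma> x"
  by (auto simp: cyl_XYo_def)

lemma cyl_Y_simps [simp]:
  "(Inl x, z) \<notin> cyl_Y Y"
  "(z, Inl x) \<notin> cyl_Y Y"
  "(Inr y, Inr y') \<in> cyl_Y Y \<longleftrightarrow> (y, y') \<in> Y"
  by (auto simp: cyl_Y_def)

lemma finite_poset_cylinder:
  assumes X: "finite_poset X" and Y: "finite_poset Y"
    and \<sigma>: "\<And>x x'. (x, x') \<in> X \<Longrightarrow> (\<sigma> x, \<sigma> x') \<in> Y"
  shows "finite_poset (cylinder X Y \<sigma>)"
proof -
  let ?\<Gamma> = "cylinder X Y \<sigma>"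
  have X': "\<And>x. x \<in> Field X \<Longrightarrow> (x, x) \<in> X" "trans X" "antisym X" "finite X"
    and Y': "\<And>y. y \<in> Field Y \<Longrightarrow> (y, y) \<in> Y" "trans Y" "antisym Y" "finite Y"
    using X Y by (auto simp: finite_poset_def partial_order_on_def preorder_on_def refl_on_def)
  have "?\<Gamma> \<subseteq> (Field X <+> Field Y) \<times> (Field X <+> Field Y)"
    by (auto simp: cylinder_def cyl_X_def cyl_Y_def cyl_XY_def intro: FieldI1 FieldI2)
  moreover from this have fld: "Field ?\<Gamma> \<subseteq> Field X <+> Field Y"
    unfolding Field_def by blast
  moreover have "finite (Field X <+> Field Y)"
    using X'(4) Y'(4) by (simp add: finite_Field)
  ultimately have "finite ?\<Gamma>"
    using finite_subset finite_cartesian_product by blast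
  moreover have "refl_on (Field ?\<Gamma>) ?\<Gamma>"
    unfolding refl_on_def using fld X'(1) Y'(1) by auto
  moreover have "trans ?\<Gamma>"
  proof (rule transI)
    fix u v w
    assume "(u, v) \<in> ?\<Gamma>" "(v, w) \<in> ?\<Gamma>"
    then show "(u, w) \<in> ?\<Gamma>"
      using X'(2) Y'(2) \<sigma>
      by (cases u; cases v; cases w) (auto dest: transD intro: FieldI1 transD[OF Y'(2) \<sigma>])
  qed
  moreover have "antisym ?\<Gamma>"
  proof (rule antisymI)
    fix u v
    assume "(u, v) \<in> ?\<Gamma>" "(v, u) \<in> ?\<Gamma>"
    then show "u = v"
      using X'(3) Y'(3) by (cases u; cases v) (auto dest: antisymD)
  qed
  moreover have "?\<Gamma> \<subseteq> Field ?\<Gamma> \<times> Field ?\<Gamma>"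
    by (auto intro: FieldI1 FieldI2)
  ultimately show ?thesis
    by (simp add: finite_poset_def partial_order_on_def preorder_on_def)
qed

lemma sum_over_Inl_Inr:
  assumes "finite S"
  shows "sum f S = (\<Sum>x\<in>{x. Inl x \<in> S}. f (Inl x)) + (\<Sum>y\<in>{y. Inr y \<in> S}. f (Inr y))"
proof -
  have fin: "finite {x. Inl x \<in> S}" "finite {y. Inr y \<in> S}"
    using assms by (auto intro: finite_vimageI[of S Inl, unfolded vimage_def]
        finite_vimageI[of S Inr, unfolded vimage_def])
  have "S = {x. Inl x \<in> S} <+> {y. Inr y \<in> S}"
    by (auto simp: Plus_def image_iff) (metis sum.exhaust)
  then have "sum f S = sum f ({x. Inl x \<in> S} <+> {y. Inr y \<in> S})"
    by simp
  also have "\<dots> = (\<Sum>x\<in>{x. Inl x \<in> S}. f (Inl x)) + (\<Sum>y\<in>{y. Inr y \<in> S}. f (Inr y))"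
    using fin by (simp add: sum.Plus)
  finally show ?thesis .
qed

text \<open>The new case is an interval from X to Y. Its X-part is summed along the fibres of
  \<sigma>; by the last condition on a strong formal subdivision each fibre contributes the sign of
  its image. The shift by 1 in \<open>cyl_rank\<close> then makes the Y-part cancel the
  X-part.\<close>

lemma cylinder_alternating_sum:
  assumes X: "lower_eulerian X \<rho>X" and Y: "lower_eulerian Y \<rho>Y"
    and \<sigma>: "strong_formal_subdivision X \<rho>X Y \<rho>Y \<sigma>"
    and z: "(z, z') \<in> cylinder X Y \<sigma>" "z \<noteq> z'"
  shows "(\<Sum>w\<in>{w. (z, w) \<in> cylinder X Y \<sigma> \<and> (w, z') \<in> cylinder X Y \<sigma>}.
    neg_one_pow (cyl_rank \<rho>X \<rho>Y w)) = 0"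
proof -
  let ?\<Gamma> = "cylinder X Y \<sigma>"
  let ?I = "{w. (z, w) \<in> ?\<Gamma> \<and> (w, z') \<in> ?\<Gamma>}"
  have mono: "(\<sigma> x, \<sigma> x') \<in> Y" if "(x, x') \<in> X" for x x'
    using \<sigma> that by (simp add: strong_formal_subdivision_def)
  have "finite_poset X" "finite_poset Y"
    using X Y by (simp_all add: lower_eulerian_def)
  then have fin: "finite X" "finite Y" "finite ?\<Gamma>" and trans: "trans Y"
    using finite_poset_cylinder[of X Y \<sigma>] mono
    by (auto simp: finite_poset_def partial_order_on_def preorder_on_def)
  have "finite (Field ?\<Gamma>)"
    using fin by (simp add: finite_Field)
  then have "finite ?I"
    by (rule rev_finite_subset) (auto intro: FieldI1)
  note split = sum_over_Inl_Inr[OF this, of "\<lambda>w. neg_one_pow (cyl_rank \<rho>X \<rho>Y w)"]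
  have alt_X: "(\<Sum>w\<in>{w. (x, w) \<in> X \<and> (w, x') \<in> X}. neg_one_pow (\<rho>X w)) = 0"
    if "(x, x') \<in> X" "x \<noteq> x'" for x x'
    using X that by (simp add: lower_eulerian_def)
  have alt_Y: "(\<Sum>w\<in>{w. (y, w) \<in> Y \<and> (w, y') \<in> Y}. neg_one_pow (\<rho>Y w)) = 0"
    if "(y, y') \<in> Y" "y \<noteq> y'" for y y'
    using Y that by (simp add: lower_eulerian_def)
  have shift: "neg_one_pow (k + 1) = - neg_one_pow k" for k
    by (simp add: neg_one_pow_eq)
  show ?thesis
  proof (cases z)
    case z_Inr: (Inr y)
    then obtain y' where "z' = Inr y'"
      using z by (cases z') auto
    then show ?thesis
      unfolding split using z z_Inr alt_Y[of y y'] by (simp add: cyl_rank_def shift sum_negf)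
  next
    case z_Inl: (Inl x)
    show ?thesis
    proof (cases z')
      case (Inl x')
      then show ?thesis
        unfolding split using z z_Inl alt_X[of x x'] by (simp add: cyl_rank_def)
    next
      case (Inr y)
      then have x: "x \<in> Field X" and xy: "(\<sigma> x, y) \<in> Y"
        using z z_Inl by auto
      let ?S = "{x'. (x, x') \<in> X \<and> x' \<in> Field X \<and> (\<sigma> x', y) \<in> Y}"
      let ?T = "{y'. (\<sigma> x, y') \<in> Y \<and> (y', y) \<in> Y}"
      have "finite ?S" "finite ?T"
        using fin(1,2)[THEN finite_Field]
        by (auto elim!: rev_finite_subset intro: FieldI1)
      moreover have "\<sigma> ` ?S \<subseteq> ?T"
        using mono by auto
      ultimately have "(\<Sum>x'\<in>?S. neg_one_pow (\<rho>X x'))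
          = (\<Sum>y'\<in>?T. \<Sum>x'\<in>{x' \<in> ?S. \<sigma> x' = y'}. neg_one_pow (\<rho>X x'))"
        by (rule sum.group[symmetric])
      also have "\<dots> = (\<Sum>y'\<in>?T. neg_one_pow (\<rho>Y y'))"
      proof (intro sum.cong refl)
        fix y'
        assume y': "y' \<in> ?T"
        have "{x' \<in> ?S. \<sigma> x' = y'} = {x'. (x, x') \<in> X \<and> \<sigma> x' = y'}"
          using y' by (auto intro: FieldI2)
        moreover have "(\<Sum>x'\<in>{x'. (x, x') \<in> X \<and> \<sigma> x' = y'}. neg_one_pow (\<rho>Y y' - \<rho>X x')) = 1"
          using \<sigma> x y' by (simp add: strong_formal_subdivision_def)
        \<comment> \<open>A sign times the fibre sum is 1, so the fibre sum equals that
          sign.\<close>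
        then have "neg_one_pow (\<rho>Y y') * (\<Sum>x'\<in>{x'. (x, x') \<in> X \<and> \<sigma> x' = y'}. neg_one_pow (\<rho>X x')) = 1"
          by (simp add: neg_one_pow_diff sum_distrib_left)
        ultimately show "(\<Sum>x'\<in>{x' \<in> ?S. \<sigma> x' = y'}. neg_one_pow (\<rho>X x')) = neg_one_pow (\<rho>Y y')"
          by (simp add: neg_one_pow_eq split: if_splits)
      qed
      finally show ?thesis
        unfolding split using z_Inl Inr x by (simp add: cyl_rank_def shift sum_negf)
    qed
  qed
qed

section \<open>Recovering \<Delta>, supports of products, and scalar division\<close>

context weakly_ranked_poset
begin

text \<open>In degrees below r/2 the reversal of \<open>m\<close> has no coefficients, so the
  equation gives m_i = l_i - l_(i-1), the coefficient used in \<open>inc_Delta\<close>. In the other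
  degrees both sides vanish.\<close>

lemma inc_Delta_unique:
  assumes m: "m \<in> inc_half B r" and diag: "\<And>z. m z z = 0"
    and rev: "inc_rev r m = (\<lambda>z z'. inc_smult [:- 1, 1:] l z z' + m z z')"
  shows "inc_Delta B r l = m"
proof (intro ext)
  fix z z'
  show "inc_Delta B r l z z' = m z z'"
  proof (cases "(z, z') \<in> B \<and> z \<noteq> z'")
    case True
    let ?n = "r z z'" and ?l = "l z z'"
    have n: "?n > 0" and deg: "2 * degree (m z z') < ?n"
      using True m by (auto intro: rank_pos simp: inc_half_iff)
    show ?thesis
    proof (rule poly_eqI)
      fix i
      have "coeff (inc_Delta B r l z z') i = (if i = 0 then coeff ?l 0 else 0) +
          (\<Sum>j=1..(?n - 1) div 2. if j = i then coeff ?l j - coeff ?l (j - 1) else 0)"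
        using True by (simp add: inc_Delta_def coeff_sum coeff_monom)
      also have "\<dots> = (if i = 0 then coeff ?l 0
          else if 2 * i < ?n then coeff ?l i - coeff ?l (i - 1) else 0)"
        using n by (auto simp: sum.delta)
      finally have Delta: "coeff (inc_Delta B r l z z') i = \<dots>" .
      show "coeff (inc_Delta B r l z z') i = coeff (m z z') i"
      proof (cases "2 * i < ?n")
        case True
        have "coeff (inc_rev r m z z') i = 0"
          using True deg by (simp add: inc_rev_eq_poly_rev coeff_poly_rev coeff_eq_0)
        then have "coeff ([:- 1, 1:] * ?l) i + coeff (m z z') i = 0"
          by (simp add: rev inc_smult_def)
        then show ?thesis
          unfolding Delta using True by (cases i) (auto simp: coeff_pCons)
      next
        case False
        then show ?thesis
          using deg n by (auto simp: Delta coeff_eq_0)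
      qed
    qed
  next
    case False
    then show ?thesis
      using m diag by (auto simp: inc_Delta_def inc_half_iff inc_deg_def incidence_algebra_def)
  qed
qed

text \<open>A support closed under enlarging the right endpoint survives multiplication on the
  right. The intervals from X to Y form such a set.\<close>

lemma inc_mult_vanishes:
  assumes "\<And>z z'. (z, z') \<notin> S \<Longrightarrow> p z z' = 0"
    and "\<And>z w z'. (z, w) \<in> S \<Longrightarrow> (w, z') \<in> B \<Longrightarrow> (z, z') \<in> S"
    and "(z, z') \<notin> S"
  shows "inc_mult B p q z z' = 0"
  unfolding inc_mult_def
proof (intro sum.neutral ballI)
  fix w
  assume "w \<in> interval z z'"
  then have "(z, w) \<notin> S"
    using assms(2,3) by blast
  then show "p z w * q w z' = 0"
    by (simp add: assms(1))
qed

lemma inc_smult_quotient_exists: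
  assumes k: "k \<in> inc_deg B r" and dvd: "\<And>z z'. c dvd k z z'" and c: "c \<noteq> 0"
  obtains k' where "k' \<in> inc_deg B r" "inc_smult c k' = k"
proof -
  obtain k' where k': "\<And>z z'. k z z' = c * k' z z'"
    using dvd unfolding dvd_def by metis
  have "degree (k' z z') \<le> degree (k z z')" for z z'
    using c by (cases "k' z z' = 0") (simp_all add: k' degree_mult_eq)
  then have "k' \<in> inc_deg B r"
    using k k' c by (fastforce simp: inc_deg_def incidence_algebra_def intro: order_trans)
  moreover have "inc_smult c k' = k"
    by (intro ext) (simp add: inc_smult_def k')
  ultimately show thesis
    using that by blast
qed

end

theorem theorem3p10:
  fixes X :: "'a rel" and Y :: "'b rel"
    and \<rho>X :: "'a \<Rightarrow> int" and \<rho>Y :: "'b \<Rightarrow> int" and \<sigma> :: "'a \<Rightarrow> 'b"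
    and \<Gamma> :: "('a + 'b) rel" and r :: "'a + 'b \<Rightarrow> 'a + 'b \<Rightarrow> nat"
    and \<kappa> g l gY :: "('a + 'b) inc"
  assumes "lower_eulerian X \<rho>X" and "lower_eulerian Y \<rho>Y"
    and "strong_formal_subdivision X \<rho>X Y \<rho>Y \<sigma>"
  defines "\<Gamma> \<equiv> cylinder X Y \<sigma>"
  assumes "weak_rank_function \<Gamma> r"
    and "\<kappa> \<in> inc_deg \<Gamma> r \<inter> inc_unital \<Gamma>"
    and "multiplicative \<Gamma> \<kappa>"
    and "rank_alternating (cyl_rank \<rho>X \<rho>Y) r \<kappa>"
  defines "g \<equiv> left_KLS \<Gamma> r \<kappa>"
    and "l \<equiv> local_h X Y \<sigma> r \<kappa>"
    and "gY \<equiv> inc_restrict (left_KLS \<Gamma> r \<kappa>) (cyl_Y Y)"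
  shows "inc_restrict g (cyl_XY X Y \<sigma>) = inc_mult \<Gamma> (inc_Delta \<Gamma> r l) g
    \<and> inc_mult \<Gamma> (inc_Delta \<Gamma> r l) g = inc_mult \<Gamma> (inc_Delta \<Gamma> r l) gY
    \<and> (\<forall>x\<in>Field X. \<forall>y. (\<sigma> x, y) \<in> Y \<longrightarrow>
         g (Inl x) (Inr y) =
           (\<Sum>y'\<in>{y'. (\<sigma> x, y') \<in> Y \<and> (y', y) \<in> Y}.
              inc_Delta \<Gamma> r l (Inl x) (Inr y') * gY (Inr y') (Inr y)))"
proof -
  have mono: "(\<sigma> x, \<sigma> x') \<in> Y" if "(x, x') \<in> X" for x x'
    using assms(3) that by (simp add: strong_formal_subdivision_def)
  have "finite_poset X" "finite_poset Y"
    using assms(1,2) by (simp_all add: lower_eulerian_def)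
  then have refl_Y: "\<And>y. y \<in> Field Y \<Longrightarrow> (y, y) \<in> Y"
    and trans_Y: "\<And>y y' y''. (y, y') \<in> Y \<Longrightarrow> (y', y'') \<in> Y \<Longrightarrow> (y, y'') \<in> Y"
    by (auto simp: finite_poset_def partial_order_on_def preorder_on_def refl_on_def dest: transD)
  have \<sigma>_Field: "\<sigma> x \<in> Field Y" if "x \<in> Field X" for x
    using assms(3) that by (auto simp: strong_formal_subdivision_def)
  have \<sigma>_lift: "\<exists>x'. (x, x') \<in> X \<and> \<rho>X x' = \<rho>Y y \<and> \<sigma> x' = y"
    if "x \<in> Field X" "(\<sigma> x, y) \<in> Y" for x y
    using assms(3) that by (simp add: strong_formal_subdivision_def)
  interpret weakly_ranked_poset \<Gamma> r
    using finite_poset_cylinder[of X Y \<sigma>] \<open>finite_poset X\<close> \<open>finite_poset Y\<close> mono assms(5)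
    by unfold_locales (simp_all add: \<Gamma>_def)
  note [simp] = cylinder_simps[of _ _ X Y \<sigma>, folded \<Gamma>_def]
  let ?XY = "cyl_XY X Y \<sigma>" and ?t = "[:- 1, 1:] :: int poly"
  have \<kappa>: "\<kappa> \<in> inc_deg \<Gamma> r" "\<kappa> \<in> inc_unital \<Gamma>"
    using assms(6) by auto
  have "inc_mult \<Gamma> \<kappa> (inc_rev r \<kappa>) = inc_one \<Gamma>"
    using \<kappa>(2) assms(7,8)
  proof (rule multiplicative_rank_alternating_kernel)
    fix z z'
    assume "(z, z') \<in> \<Gamma>" "z \<noteq> z'"
    then show "(\<Sum>w\<in>interval z z'. neg_one_pow (cyl_rank \<rho>X \<rho>Y w)) = 0"
      using cylinder_alternating_sum[OF assms(1-3)] by (simp add: \<Gamma>_def)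
  qed
  note g = left_KLS[OF \<kappa> this, folded g_def]
  have g_mem: "g \<in> inc_deg \<Gamma> r" "g \<in> incidence_algebra \<Gamma>"
    using g(1) by (simp_all add: inc_half_def inc_deg_def)
  define gi where "gi = inc_inverse \<Gamma> g"
  note gi = inc_inverse[OF g(2), folded gi_def]
  have gi_half: "gi \<in> inc_half \<Gamma> r"
    using g(1,2) inc_inverse_mem_half by (simp add: gi_def)

  define k where "k = inc_restrict \<kappa> (cyl_XYo X \<sigma>)"
  \<comment> \<open>The lifting condition at y = \<sigma>(x) gives x' above x with [x', \<sigma>(x)]
    of cylinder rank 1. Rank alternation makes \<kappa> antipalindromic there, so it vanishes at t =
    1; multiplicativity passes the factor t - 1 on to [x, \<sigma>(x)].\<close>
  have "?t dvd \<kappa> (Inl x) (Inr (\<sigma> x))" if x: "x \<in> Field X" for x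
  proof -
    have "(\<sigma> x, \<sigma> x) \<in> Y"
      using x \<sigma>_Field refl_Y by simp
    then obtain x' where x': "(x, x') \<in> X" "\<rho>X x' = \<rho>Y (\<sigma> x)" "\<sigma> x' = \<sigma> x"
      using \<sigma>_lift x by blast
    let ?p = "\<kappa> (Inl x') (Inr (\<sigma> x))"
    have le: "(Inl x, Inl x') \<in> \<Gamma>" "(Inl x', Inr (\<sigma> x)) \<in> \<Gamma>"
      using x' \<open>(\<sigma> x, \<sigma> x) \<in> Y\<close> by (auto intro: FieldI2)
    have "poly_rev (r (Inl x') (Inr (\<sigma> x))) ?p = - ?p"
      using assms(8) x'(2)
      by (simp add: rank_alternating_def cyl_rank_def inc_hat_def neg_one_pow_eq
          flip: inc_rev_eq_poly_rev)
    then have "poly ?p 1 = - poly ?p 1"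
      using poly_poly_rev_1[OF inc_degD[OF \<kappa>(1) le(2)]] by simp
    then have "?t dvd ?p"
      by (simp add: poly_eq_0_iff_dvd)
    moreover have "\<kappa> (Inl x) (Inr (\<sigma> x)) = \<kappa> (Inl x) (Inl x') * ?p"
      using assms(7) le unfolding multiplicative_def by blast
    ultimately show ?thesis
      by simp
  qed
  then have "?t dvd k z z'" for z z'
    by (auto simp: k_def inc_restrict_def cyl_XYo_def)
  moreover have "k \<in> inc_deg \<Gamma> r"
    using \<kappa>(1) by (simp add: k_def inc_restrict_mem_deg)
  ultimately obtain k' where k': "k' \<in> inc_deg \<Gamma> r" "inc_smult ?t k' = k"
    using inc_smult_quotient_exists[of k ?t] by auto
  \<comment> \<open>Dividing \<open>k\<close> by t - 1 before multiplying by \<open>g\<close> gives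
    the quotient at once. It is the only one because integer polynomials have no zero
    divisors.\<close>
  define h where "h = inc_mult \<Gamma> g k'"
  have h: "h \<in> inc_deg \<Gamma> r" "inc_smult ?t h = inc_mult \<Gamma> g k"
    using k' g_mem by (simp_all add: h_def inc_mult_mem_deg flip: inc_mult_smult_right)
  have "h_poly X Y \<sigma> r \<kappa> = h"
    unfolding h_poly_def Let_def \<Gamma>_def[symmetric] g_def[symmetric] k_def[symmetric]
  proof (rule the_equality)
    fix h'
    assume "h' \<in> inc_deg \<Gamma> r \<and> inc_smult ?t h' = inc_mult \<Gamma> g k"
    then have "inc_smult ?t h' = inc_smult ?t h"
      using h by simp
    then have "?t * h' z z' = ?t * h z z'" for z z'
      unfolding inc_smult_def by metis
    then show "h' = h"
      by (intro ext) (metis mult_left_cancel pCons_eq_0_iff zero_neq_one)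
  qed (use h in simp)
  then have l: "l = inc_mult \<Gamma> h gi"
    by (simp add: l_def local_h_def Let_def gi_def g_def flip: \<Gamma>_def)
  have lg: "inc_mult \<Gamma> l g = h"
    using inc_deg_subset_algebra[OF h(1)] by (simp add: l inc_mult_assoc gi inc_mult_one_right)

  define m where "m = inc_mult \<Gamma> (inc_restrict g ?XY) gi"
  have gXY_half: "inc_restrict g ?XY \<in> inc_half \<Gamma> r"
    using g(1) by (auto simp: inc_half_iff inc_restrict_mem_deg) (auto simp: inc_restrict_def intro: rank_pos)
  have m_half: "m \<in> inc_half \<Gamma> r"
    using gXY_half gi_half by (simp add: m_def inc_mult_mem_half)
  have m_deg: "m \<in> inc_deg \<Gamma> r"
    using m_half by (simp add: inc_half_def)
  have mg: "inc_mult \<Gamma> m g = inc_restrict g ?XY"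
    using inc_deg_subset_algebra[OF inc_restrict_mem_deg[OF g_mem(1)]]
    by (simp add: m_def inc_mult_assoc gi inc_mult_one_right)
  have m_XY: "m z z' = 0" if "(z, z') \<notin> ?XY" for z z'
    unfolding m_def
  proof (rule inc_mult_vanishes[OF _ _ that])
    fix z w z'
    assume "(z, w) \<in> ?XY" "(w, z') \<in> \<Gamma>"
    then show "(z, z') \<in> ?XY"
      by (cases z; cases w; cases z') (auto intro: trans_Y)
  qed (simp add: inc_restrict_def)

  have k\<kappa>: "inc_mult \<Gamma> k \<kappa> = inc_restrict \<kappa> ?XY"
  proof (intro ext)
    fix z z'
    show "inc_mult \<Gamma> k \<kappa> z z' = inc_restrict \<kappa> ?XY z z'"
    proof (cases "(z, z') \<in> ?XY")
      case True
      then obtain x y where z: "z = Inl x" "z' = Inr y" "x \<in> Field X" "(\<sigma> x, y) \<in> Y"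
        by (auto simp: cyl_XY_def)
      then have mem: "(z, Inr (\<sigma> x)) \<in> \<Gamma>" "(Inr (\<sigma> x), z') \<in> \<Gamma>"
        using \<sigma>_Field refl_Y by auto
      \<comment> \<open>The support of \<open>k\<close> leaves only w = \<sigma>(x), and \<kappa> is
        multiplicative through that point.\<close>
      have "inc_mult \<Gamma> k \<kappa> z z' = (\<Sum>w\<in>{Inr (\<sigma> x)}. k z w * \<kappa> w z')"
        unfolding inc_mult_def
      proof (rule sum.mono_neutral_right[OF finite_interval])
        show "\<forall>w\<in>interval z z' - {Inr (\<sigma> x)}. k z w * \<kappa> w z' = 0"
        proof
          fix w
          assume "w \<in> interval z z' - {Inr (\<sigma> x)}"
          then show "k z w * \<kappa> w z' = 0"
            by (cases w) (auto simp: k_def inc_restrict_def z)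
        qed
      qed (use mem in simp)
      also have "\<dots> = \<kappa> z (Inr (\<sigma> x)) * \<kappa> (Inr (\<sigma> x)) z'"
        by (simp add: k_def inc_restrict_def z)
      also have "\<dots> = \<kappa> z z'"
        using assms(7) mem unfolding multiplicative_def by metis
      finally show ?thesis
        using True by (simp add: inc_restrict_def)
    next
      case False
      have "inc_mult \<Gamma> k \<kappa> z z' = 0"
      proof (rule inc_mult_vanishes[OF _ _ False])
        fix z z'
        assume "(z, z') \<notin> ?XY"
        then show "k z z' = 0"
          using \<sigma>_Field refl_Y by (cases z; cases z') (auto simp: k_def inc_restrict_def)
      next
        fix z w z'
        assume "(z, w) \<in> ?XY" "(w, z') \<in> \<Gamma>"
        then show "(z, z') \<in> ?XY"
          by (cases z; cases w; cases z') (auto intro: trans_Y)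
      qed
      then show ?thesis
        using False by (simp add: inc_restrict_def)
    qed
  qed

  have split: "inc_restrict (inc_mult \<Gamma> g \<kappa>) ?XY = (\<lambda>z z'.
    inc_mult \<Gamma> g (inc_restrict \<kappa> ?XY) z z' + inc_mult \<Gamma> (inc_restrict g ?XY) \<kappa> z z')"
  proof (intro ext)
    fix z z'
    \<comment> \<open>An intermediate w lies in X or in Y. In the first case [w, z'] crosses from X
      to Y, in the second [z, w] does, so exactly one summand on the right survives.\<close>
    have "(if (z, z') \<in> ?XY then g z w * \<kappa> w z' else 0)
        = g z w * inc_restrict \<kappa> ?XY w z' + inc_restrict g ?XY z w * \<kappa> w z'"
      if "w \<in> interval z z'" for w
      using that by (cases z; cases w; cases z') (auto simp: inc_restrict_def intro: FieldI1 FieldI2 trans_Y mono)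
    then have "(\<Sum>w\<in>interval z z'. if (z, z') \<in> ?XY then g z w * \<kappa> w z' else 0)
        = inc_mult \<Gamma> g (inc_restrict \<kappa> ?XY) z z' + inc_mult \<Gamma> (inc_restrict g ?XY) \<kappa> z z'"
      unfolding inc_mult_def sum.distrib[symmetric] by (intro sum.cong) auto
    then show "inc_restrict (inc_mult \<Gamma> g \<kappa>) ?XY z z' = \<dots>"
      by (auto simp: inc_restrict_def inc_mult_def)
  qed

  \<comment> \<open>The reversal of \<open>m\<close> times \<open>g\<close> is computed in two ways,
    with a right factor \<open>g\<close> times \<kappa> on both sides. First \<kappa> and then
    \<open>g\<close> is cancelled, both being unital and hence invertible.\<close>
  have "inc_mult \<Gamma> (inc_mult \<Gamma> (inc_rev r m) g) \<kappa> = inc_rev r (inc_mult \<Gamma> m g)"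
    by (simp add: inc_mult_assoc inc_rev_mult m_deg g_mem g(3))
  also have "\<dots> = inc_restrict (inc_mult \<Gamma> g \<kappa>) ?XY"
    by (simp add: mg fun_eq_iff inc_restrict_def inc_rev_eq_poly_rev flip: g(3))
  also have "\<dots> = (\<lambda>z z'. inc_mult \<Gamma> (inc_mult \<Gamma> (inc_smult ?t l) g) \<kappa> z z'
      + inc_mult \<Gamma> (inc_mult \<Gamma> m g) \<kappa> z z')"
    by (simp add: split lg mg h inc_mult_smult_left inc_mult_assoc flip: k\<kappa>)
  also have "\<dots> = inc_mult \<Gamma> (inc_mult \<Gamma> (\<lambda>z z'. inc_smult ?t l z z' + m z z') g) \<kappa>"
    by (simp add: inc_mult_add_left)
  finally have "inc_mult \<Gamma> (inc_rev r m) g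
      = inc_mult \<Gamma> (\<lambda>z z'. inc_smult ?t l z z' + m z z') g"
    by (rule inc_mult_right_cancel[OF \<kappa>(2) inc_mult_mem inc_mult_mem])
  moreover have "inc_rev r m \<in> incidence_algebra \<Gamma>"
    using m_deg by (simp add: inc_deg_def incidence_algebra_def inc_rev_eq_poly_rev)
  moreover have "(\<lambda>z z'. inc_smult ?t l z z' + m z z') \<in> incidence_algebra \<Gamma>"
    using m_deg inc_mult_mem[of h gi]
    by (simp add: inc_deg_def incidence_algebra_def inc_smult_def flip: l)
  ultimately have "inc_rev r m = (\<lambda>z z'. inc_smult ?t l z z' + m z z')"
    using inc_mult_right_cancel[OF g(2)] by blast
  moreover have "m z z = 0" for z
    by (cases z) (simp_all add: m_XY)
  ultimately have \<Delta>: "inc_Delta \<Gamma> r l = m"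
    using inc_Delta_unique[OF m_half] by blast

  \<comment> \<open>Only w in Y contributes, as \<open>m\<close> is supported on intervals from X to
    Y, and above such w the functions \<open>g\<close> and \<open>gY\<close> agree.\<close>
  have mgY: "inc_mult \<Gamma> m g = inc_mult \<Gamma> m gY"
  proof (intro ext)
    fix z z'
    show "inc_mult \<Gamma> m g z z' = inc_mult \<Gamma> m gY z z'"
      unfolding inc_mult_def
    proof (intro sum.cong refl)
      fix w
      assume "w \<in> interval z z'"
      then show "m z w * g w z' = m z w * gY w z'"
        by (cases w; cases z') (auto simp: m_XY gY_def inc_restrict_def g_def)
    qed
  qed
  have "g (Inl x) (Inr y) = (\<Sum>y'\<in>{y'. (\<sigma> x, y') \<in> Y \<and> (y', y) \<in> Y}. m (Inl x) (Inr y') * gY (Inr y') (Inr y))"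
    if "x \<in> Field X" "(\<sigma> x, y) \<in> Y" for x y
  proof -
    have "g (Inl x) (Inr y) = inc_mult \<Gamma> m gY (Inl x) (Inr y)"
      using that by (simp add: mg inc_restrict_def flip: mgY)
    then show ?thesis
      using that by (simp add: inc_mult_def sum_over_Inl_Inr[OF finite_interval] m_XY)
  qed
  then show ?thesis
    by (simp add: \<Delta> mg flip: mgY)
qed

end
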